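(* Let $q=p^n$, where $p$ is an odd prime and $n$ is any positive integer. Then the power graph of $\mathrm{PSU}(3,q)$ is not a chordal graph.
   Context: The power graph $\mathcal{P}(G)$ of a group $G$ is the undirected simple graph with vertex set $G$ in which distinct $a,b$ are adjacent iff $a=b^m$ or $b=a^n$ for some positive integers $m,n$. A graph is chordal if it has no induced cycle of length $4$ or more. $\mathrm{PSU}(3,q)$ is the projective special unitary group of degree $3$ defined over the field $GF(q^2)$, i.e. $\mathrm{SU}(3,q)/Z(\mathrm{SU}(3,q))$. *)

theory Defs
  imports
    "HOL-Analysis.Determinants"
    "HOL-Algebra.Coset"
    "HOL-Number_Theory.Residues"
    "Graph_Theory.Pair_Digraph"
begin

section \<open>Power graphs and chordal graphs\<close>

text \<open>
  An undirected simple graph is represented as a symmetric loop-free digraph without parallel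
  arcs, the locale \<^locale>\<open>pair_bidirected_digraph\<close>.
\<close>

definition power_graph :: "('a, 'b) monoid_scheme \<Rightarrow> 'a pair_pre_digraph" where
  "power_graph G =
     \<lparr> pverts = carrier G,
       parcs = {(a, b). a \<in> carrier G \<and> b \<in> carrier G \<and> a \<noteq> b \<and>
                  ((\<exists>m::nat. m > 0 \<and> a = b [^]\<^bsub>G\<^esub> m) \<or> (\<exists>n::nat. n > 0 \<and> b = a [^]\<^bsub>G\<^esub> n))} \<rparr>"

lemma pair_bidirected_power_graph: "pair_bidirected_digraph (power_graph G)"
proof unfold_locales
  show "symmetric (power_graph G)"
    unfolding symmetric_def with_proj_simps by (rule symI) (simp add: power_graph_def, blast)
qed (simp_all add: power_graph_def case_prod_beta)

text \<open>
  The distinct vertices listed in \<open>c\<close>, in this cyclic order, induce a cycle: two of them are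
  adjacent iff they are cyclically consecutive.  The description is meaningful for lists of
  length at least 3.
\<close>

definition induced_cycle :: "'a pair_pre_digraph \<Rightarrow> 'a list \<Rightarrow> bool" where
  "induced_cycle H c \<longleftrightarrow>
     distinct c \<and> set c \<subseteq> pverts H \<and>
     (\<forall>i < length c. \<forall>j < length c.
        (c ! i, c ! j) \<in> parcs H \<longleftrightarrow>
          j = Suc i mod length c \<or> i = Suc j mod length c)"

definition chordal :: "'a pair_pre_digraph \<Rightarrow> bool" where
  "chordal H \<longleftrightarrow> \<not> (\<exists>c. length c \<ge> 4 \<and> induced_cycle H c)"


section \<open>Projective special unitary groups\<close>

text \<open>
  Over a field with \<open>q\<^sup>2\<close> elements, \<open>x \<mapsto> x ^ q\<close> is the automorphism of order 2 used as
  conjugation.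
\<close>

definition conj_transpose :: "nat \<Rightarrow> 'k::field ^ 'n ^ 'm \<Rightarrow> 'k ^ 'm ^ 'n" where
  "conj_transpose q A = (\<chi> i j. (A $ j $ i) ^ q)"

text \<open>
  \<open>SU q\<close> is the special unitary group of degree \<open>CARD('n)\<close> of the standard Hermitian form
  \<open>\<Sum>i. x\<^sub>i * y\<^sub>i ^ q\<close>; it has its intended meaning when \<open>CARD('k) = q\<^sup>2\<close>.
\<close>

definition SU :: "nat \<Rightarrow> ('k::field ^ 'n ^ 'n) monoid" where
  "SU q = \<lparr> carrier = {A. A ** conj_transpose q A = mat 1 \<and> det A = 1},
            mult = (**), one = mat 1 \<rparr>"

definition group_center :: "('a, 'b) monoid_scheme \<Rightarrow> 'a set" where
  "group_center G = {z \<in> carrier G. \<forall>g \<in> carrier G. z \<otimes>\<^bsub>G\<^esub> g = g \<otimes>\<^bsub>G\<^esub> z}"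

definition PSU :: "nat \<Rightarrow> ('k::field ^ 'n ^ 'n) set monoid" where
  "PSU q = SU q Mod group_center (SU q)"

lemma (in group) group_center_normal: "group_center G \<lhd> G"
proof -
  have cen: "z \<in> group_center G \<longleftrightarrow> z \<in> carrier G \<and> (\<forall>g \<in> carrier G. z \<otimes> g = g \<otimes> z)" for z
    by (simp add: group_center_def)
  have sub: "subgroup (group_center G) G"
  proof (rule subgroupI)
    show "group_center G \<subseteq> carrier G" by (auto simp: cen)
    have "\<one> \<in> group_center G" by (simp add: cen)
    then show "group_center G \<noteq> {}" by blast
  next
    fix a assume a: "a \<in> group_center G"
    have ac: "a \<in> carrier G" using a unfolding cen by blast
    have "inv a \<otimes> g = g \<otimes> inv a" if g: "g \<in> carrier G" for g
    proof -
      have "a \<otimes> g = g \<otimes> a" using a g unfolding cen by blast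
      then have "a \<otimes> (g \<otimes> inv a) = g \<otimes> a \<otimes> inv a" using ac g by (simp flip: m_assoc)
      also have "\<dots> = g" using ac g by (simp add: m_assoc)
      finally show ?thesis using ac g by (simp add: inv_solve_left')
    qed
    moreover have "inv a \<in> carrier G" using ac by simp
    ultimately show "inv a \<in> group_center G" unfolding cen by blast
  next
    fix a b assume a: "a \<in> group_center G" and b: "b \<in> group_center G"
    have ab: "a \<in> carrier G" "b \<in> carrier G" using a b by (auto simp: cen)
    have "a \<otimes> b \<otimes> g = g \<otimes> (a \<otimes> b)" if g: "g \<in> carrier G" for g
    proof -
      have "a \<otimes> b \<otimes> g = a \<otimes> (b \<otimes> g)" using ab g by (rule m_assoc)
      also have "b \<otimes> g = g \<otimes> b" using b g unfolding cen by blast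
      also have "a \<otimes> (g \<otimes> b) = a \<otimes> g \<otimes> b" using ab g by (simp add: m_assoc)
      also have "a \<otimes> g = g \<otimes> a" using a g unfolding cen by blast
      also have "g \<otimes> a \<otimes> b = g \<otimes> (a \<otimes> b)" using ab g by (simp add: m_assoc)
      finally show ?thesis .
    qed
    moreover have "a \<otimes> b \<in> carrier G" using ab by simp
    ultimately show "a \<otimes> b \<in> group_center G" unfolding cen by blast
  qed
  have "x \<otimes> h \<otimes> inv x = h" if "x \<in> carrier G" "h \<in> group_center G" for x h
  proof -
    have h: "h \<in> carrier G" using that(2) unfolding cen by blast
    have "x \<otimes> h = h \<otimes> x" using that unfolding cen by simp
    then have "x \<otimes> h \<otimes> inv x = h \<otimes> x \<otimes> inv x" by simp
    also have "\<dots> = h" using that(1) h by (simp add: m_assoc)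
    finally show ?thesis .
  qed
  with sub show ?thesis unfolding normal_inv_iff by simp
qed

context
  fixes p n q :: nat
  assumes p: "prime p" and q: "q = p ^ n"
    and card: "CARD('k::{field,finite}) = q ^ 2"
begin

lemma conj_sum: "(\<Sum>i\<in>A. f i) ^ q = (\<Sum>i\<in>A. (f i :: 'k) ^ q)"
proof -
  have prime: "prime CHAR('k)" by (rule prime_CHAR_semidom) (simp add: finite_imp_CHAR_pos)
  moreover have "CHAR('k) dvd p ^ (n * 2)"
    using CHAR_dvd_CARD[where 'a='k] card q by (simp add: power_mult)
  ultimately have "CHAR('k) = p"
    using p prime_dvd_power primes_dvd_imp_eq by blast
  with prime q show ?thesis
    using freshmans_dream_sum' by blast
qed

lemma conj_transpose_mult:
  "conj_transpose q (A ** B) = conj_transpose q B ** conj_transpose q (A :: 'k ^ 'n ^ 'n)"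
  by (simp add: conj_transpose_def matrix_matrix_mult_def conj_sum power_mult_distrib vec_eq_iff
      mult.commute)

lemma conj_transpose_one: "conj_transpose q (mat 1 :: 'k ^ 'n ^ 'n) = mat 1"
proof -
  have "q > 0" using p q by (simp add: prime_gt_0_nat)
  then show ?thesis by (simp add: conj_transpose_def mat_def vec_eq_iff)
qed

lemma group_SU: "group (SU q :: ('k ^ 'n ^ 'n) monoid)"
proof (rule groupI)
  fix A B :: "'k ^ 'n ^ 'n"
  assume A: "A \<in> carrier (SU q)" and B: "B \<in> carrier (SU q)"
  have "A ** B ** (conj_transpose q B ** conj_transpose q A)
      = A ** (B ** conj_transpose q B) ** conj_transpose q A"
    by (simp only: matrix_mul_assoc)
  then show "A \<otimes>\<^bsub>SU q\<^esub> B \<in> carrier (SU q)"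
    using A B by (simp add: SU_def conj_transpose_mult det_mul)
next
  fix A :: "'k ^ 'n ^ 'n"
  assume A: "A \<in> carrier (SU q)"
  let ?B = "conj_transpose q A"
  have AB: "A ** ?B = mat 1" and det: "det A = 1" using A by (simp_all add: SU_def)
  have "conj_transpose q ?B ** ?B = mat 1"
    using arg_cong[OF AB, of "conj_transpose q"]
    by (simp add: conj_transpose_mult conj_transpose_one)
  then have "?B ** conj_transpose q ?B = mat 1" by (simp add: matrix_left_right_inverse)
  moreover have "det ?B = 1"
    using arg_cong[OF AB, of det] det by (simp add: det_mul)
  moreover have "?B ** A = mat 1" using AB by (simp add: matrix_left_right_inverse)
  ultimately show "\<exists>B \<in> carrier (SU q). B \<otimes>\<^bsub>SU q\<^esub> A = \<one>\<^bsub>SU q\<^esub>"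
    by (auto simp: SU_def)
qed (simp_all add: SU_def conj_transpose_one matrix_mul_assoc)

lemma group_PSU: "group (PSU q :: ('k ^ 'n ^ 'n) set monoid)"
  unfolding PSU_def
  using group.group_center_normal[OF group_SU] by (rule normal.factorgroup_is_group)

end

end

theory Submission
  imports Defs "HOL-Computational_Algebra.Polynomial"
begin

text \<open>
  The special unitary group of the Hermitian form \<open>\<langle>v, w\<rangle> = \<Sum>i. v\<^sub>i ^ q * w\<^sub>i\<close> on a space of dimension 3
  over the field with \<open>q\<^sup>2\<close> elements contains two kinds of elements attached to vectors.  An isotropic
  vector \<open>v\<close> gives a unitary transvection \<open>1 + c v v\<^sup>*\<close> (where \<open>c ^ q = - c \<noteq> 0\<close>), whose order is the
  characteristic \<open>p\<close>.  A vector \<open>v\<close> of norm \<open>s = \<plusminus>1\<close> gives the involution \<open>- 1 + 2 s v v\<^sup>*\<close>, which fixes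
  \<open>v\<close> and is \<open>- 1\<close> on its orthogonal complement.  Elements attached to orthogonal vectors commute;
  elements attached to two vectors that are neither orthogonal nor proportional do not.

  Take a triangle of isotropic points: three isotropic vectors \<open>P\<^sub>1, P\<^sub>2, P\<^sub>3\<close> that are linearly
  independent, with transvections \<open>u\<^sub>1, u\<^sub>2, u\<^sub>3\<close>.  The side opposite \<open>P\<^sub>j\<close> is the orthogonal complement of
  an anisotropic vector \<open>N\<^sub>j\<close>, with involution \<open>w\<^sub>j\<close>.  So \<open>u\<^sub>i\<close> and \<open>w\<^sub>j\<close> commute for \<open>i \<noteq> j\<close>, and as \<open>p\<close>
  is odd, both are powers of their product.  Walking around the triangle,
  \<open>u\<^sub>1, u\<^sub>1 w\<^sub>3, w\<^sub>3, u\<^sub>2 w\<^sub>3, u\<^sub>2, u\<^sub>2 w\<^sub>1, w\<^sub>1, u\<^sub>3 w\<^sub>1, u\<^sub>3, u\<^sub>3 w\<^sub>2, w\<^sub>2, u\<^sub>1 w\<^sub>2\<close>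
  is a closed walk of length 12 in the power graph.  It is an induced cycle, because for these
  products being a power is decided separately in the \<open>p\<close>-part and the 2-part
  (\<open>prod_is_power_iff\<close>), and no \<open>u\<^sub>i\<close> is a power of another \<open>u\<^sub>j\<close>, nor \<open>w\<^sub>i\<close> of another \<open>w\<^sub>j\<close>.

  All this survives in the quotient by the center: were \<open>u\<^sub>i\<close> equal to a power of \<open>u\<^sub>j\<close> up to a
  central factor, \<open>u\<^sub>i\<close> and \<open>u\<^sub>j\<close> would commute (\<open>center_quotient_not_chordal\<close>).  Hence neither the
  center nor the order of the group has to be computed.
\<close>

section \<open>Induced cycles in power graphs\<close>

text \<open>
  Raising \<open>u \<otimes> w\<close> to the power \<open>k + 1\<close>, which is even, isolates \<open>u\<close>; raising it to the odd power
  \<open>k\<close> isolates \<open>w\<close>.  This splits a relation between products into its two components.  Conversely,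
  exponents \<open>m\<close> and \<open>l\<close> for the components combine to the exponent \<open>m * (k + 1) + l * k\<close>.
\<close>

lemma (in group) prod_is_power_iff:
  fixes k :: nat
  assumes k: "odd k"
    and carr: "u \<in> carrier G" "w \<in> carrier G" "u' \<in> carrier G" "w' \<in> carrier G"
    and comm: "u \<otimes> w = w \<otimes> u" "u' \<otimes> w' = w' \<otimes> u'"
    and uk: "u [^] k = \<one>" "u' [^] k = \<one>"
    and w2: "w [^] (2::nat) = \<one>" "w' [^] (2::nat) = \<one>"
  shows "(\<exists>m::nat. m > 0 \<and> u \<otimes> w = (u' \<otimes> w') [^] m) \<longleftrightarrow>
         (\<exists>m::nat. m > 0 \<and> u = u' [^] m) \<and> (\<exists>m::nat. m > 0 \<and> w = w' [^] m)"
    (is "?L \<longleftrightarrow> ?R1 \<and> ?R2")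
proof -
  have ev: "even (k + 1)" using k by simp
  have red_u: "x [^] (m * (k + 1)) = x [^] m" if "x \<in> carrier G" "x [^] k = \<one>" for x and m :: nat
  proof -
    have "x [^] (m * (k + 1)) = x [^] (k * m) \<otimes> x [^] m"
      using that by (simp add: nat_pow_mult algebra_simps)
    also have "x [^] (k * m) = \<one>" using that by (simp flip: nat_pow_pow)
    finally show ?thesis using that by simp
  qed
  have even_w: "x [^] m = \<one>"
    if "x \<in> carrier G" "x [^] (2::nat) = \<one>" "even m" for x and m :: nat
  proof -
    obtain l where "m = 2 * l" using \<open>even m\<close> by (elim evenE)
    then show ?thesis using that by (simp flip: nat_pow_pow)
  qed
  have red_w: "x [^] (m * k) = x [^] m"
    if "x \<in> carrier G" "x [^] (2::nat) = \<one>" for x and m :: nat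
  proof -
    have "m * k = m * (k - 1) + m" using k by (cases k) auto
    then have "x [^] (m * k) = x [^] (m * (k - 1)) \<otimes> x [^] m"
      using that by (simp add: nat_pow_mult)
    also have "x [^] (m * (k - 1)) = \<one>" by (rule even_w[OF that]) (use k in simp)
    finally show ?thesis using that by simp
  qed
  have kill_u: "x [^] (m * k) = \<one>" if "x \<in> carrier G" "x [^] k = \<one>" for x and m :: nat
    using that by (subst mult.commute) (simp flip: nat_pow_pow)
  have kill_w: "x [^] (m * (k + 1)) = \<one>"
    if "x \<in> carrier G" "x [^] (2::nat) = \<one>" for x and m :: nat
    by (rule even_w[OF that]) (use ev in simp)
  have split: "(u \<otimes> w) [^] m = u [^] m \<otimes> w [^] m" "(u' \<otimes> w') [^] m = u' [^] m \<otimes> w' [^] m"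
    for m :: nat
    by (rule pow_mult_distrib; fact)+
  show ?thesis
  proof (intro iffI conjI)
    assume ?L
    then obtain m :: nat where m: "m > 0" and eq: "u \<otimes> w = (u' \<otimes> w') [^] m" by blast
    have pows: "u [^] l \<otimes> w [^] l = u' [^] (m * l) \<otimes> w' [^] (m * l)" for l :: nat
    proof -
      have "(u \<otimes> w) [^] l = (u' \<otimes> w') [^] (m * l)"
        using eq carr by (simp add: nat_pow_pow)
      then show ?thesis by (simp only: split)
    qed
    have "u = u' [^] m"
      using pows[of "k + 1"] red_u[of u 1] red_u[of u' m] kill_w[of w 1] kill_w[of w' m]
        carr uk w2 by simp
    then show ?R1 using m by blast
    have "w = w' [^] m"
      using pows[of k] red_w[of w 1] red_w[of w' m] kill_u[of u 1] kill_u[of u' m]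
        carr uk w2 by simp
    then show ?R2 using m by blast
  next
    assume "?R1 \<and> ?R2"
    then obtain m l :: nat where m: "m > 0" "u = u' [^] m" and l: "l > 0" "w = w' [^] l" by blast
    let ?e = "m * (k + 1) + l * k"
    have "u' [^] ?e = u' [^] (m * (k + 1)) \<otimes> u' [^] (l * k)"
      using carr by (simp only: nat_pow_mult)
    then have "u' [^] ?e = u"
      using red_u[of u' m] kill_u[of u' l] carr uk m by simp
    moreover have "w' [^] ?e = w' [^] (m * (k + 1)) \<otimes> w' [^] (l * k)"
      using carr by (simp only: nat_pow_mult)
    then have "w' [^] ?e = w"
      using red_w[of w' l] kill_w[of w' m] carr w2 l by simp
    ultimately have "u \<otimes> w = (u' \<otimes> w') [^] ?e"
      by (simp only: split)
    moreover have "?e > 0" using m by simp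
    ultimately show ?L by blast
  qed
qed

text \<open>
  Two elements are adjacent in the power graph iff they are distinct and comparable for the
  preorder ``is a power of''.  So a family on which this preorder is transported to a known partial
  order \<open>R\<close> induces the comparability graph of \<open>R\<close>.
\<close>

lemma (in monoid) not_chordal_if_power_order:
  assumes carr: "\<And>x. x \<in> set L \<Longrightarrow> f x \<in> carrier G"
    and pow: "\<And>x y. x \<in> set L \<Longrightarrow> y \<in> set L \<Longrightarrow> (\<exists>m::nat. m > 0 \<and> f x = f y [^] m) \<longleftrightarrow> R x y"
    and antisym: "\<And>x y. x \<in> set L \<Longrightarrow> y \<in> set L \<Longrightarrow> R x y \<Longrightarrow> R y x \<Longrightarrow> x = y"
    and L: "distinct L" "length L \<ge> 4"
    and cyc: "\<And>i j. i < length L \<Longrightarrow> j < length L \<Longrightarrow>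
        i \<noteq> j \<and> (R (L ! i) (L ! j) \<or> R (L ! j) (L ! i)) \<longleftrightarrow>
        j = Suc i mod length L \<or> i = Suc j mod length L"
  shows "\<not> chordal (power_graph G)"
proof -
  have self: "R x y" if "x \<in> set L" "y \<in> set L" "f x = f y" for x y
    using pow[OF that(1,2)] carr[OF that(2)] that(3) by (metis nat_pow_eone zero_less_one)
  have inj: "inj_on f (set L)"
    by (rule inj_onI) (metis antisym self)
  have "(f (L ! i), f (L ! j)) \<in> parcs (power_graph G) \<longleftrightarrow>
        j = Suc i mod length L \<or> i = Suc j mod length L"
    if ij: "i < length L" "j < length L" for i j
  proof -
    have mem: "L ! i \<in> set L" "L ! j \<in> set L" using ij by simp_all
    have "f (L ! i) = f (L ! j) \<longleftrightarrow> i = j"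
      using inj mem ij L(1) by (simp add: inj_on_eq_iff nth_eq_iff_index_eq)
    then have "(f (L ! i), f (L ! j)) \<in> parcs (power_graph G) \<longleftrightarrow>
        i \<noteq> j \<and> (R (L ! i) (L ! j) \<or> R (L ! j) (L ! i))"
      using pow[OF mem] pow[OF mem(2,1)] carr[OF mem(1)] carr[OF mem(2)]
      by (simp add: power_graph_def)
    then show ?thesis using cyc[OF ij] by simp
  qed
  then have "induced_cycle (power_graph G) (map f L)"
    using carr L(1) inj unfolding induced_cycle_def
    by (auto simp: distinct_map power_graph_def)
  then show ?thesis
    using L(2) unfolding chordal_def by (metis length_map)
qed

text \<open>
  A pair \<open>(i, j)\<close> stands for the product of the \<open>i\<close>-th transvection and the \<open>j\<close>-th involution, where
  the index 0 stands for a missing factor.  The order below is then inclusion of the sets of factors.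
\<close>

definition flag_le :: "nat \<times> nat \<Rightarrow> nat \<times> nat \<Rightarrow> bool" where
  "flag_le x y \<longleftrightarrow> (fst x = 0 \<or> fst x = fst y) \<and> (snd x = 0 \<or> snd x = snd y)"

text \<open>
  Vertices \<open>(i, 0)\<close>, sides \<open>(0, j)\<close> and incident vertex-side pairs \<open>(i, j)\<close> of a triangle, in the order
  in which they are met along its boundary; side \<open>j\<close> is opposite vertex \<open>j\<close>.
\<close>

definition triangle_flags :: "(nat \<times> nat) list" where
  "triangle_flags =
    [(1,0), (1,3), (0,3), (2,3), (2,0), (2,1), (0,1), (3,1), (3,0), (3,2), (0,2), (1,2)]"

lemma triangle_flags_cycle:
  assumes "i < length triangle_flags" "j < length triangle_flags"
  shows "i \<noteq> j \<and> (flag_le (triangle_flags ! i) (triangle_flags ! j)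
                \<or> flag_le (triangle_flags ! j) (triangle_flags ! i)) \<longleftrightarrow>
    j = Suc i mod length triangle_flags \<or> i = Suc j mod length triangle_flags"
proof -
  have "\<forall>i\<in>set [0..<12]. \<forall>j\<in>set [0..<12].
      (i \<noteq> j \<and> (flag_le (triangle_flags ! i) (triangle_flags ! j)
              \<or> flag_le (triangle_flags ! j) (triangle_flags ! i))) =
      (j = Suc i mod 12 \<or> i = Suc j mod 12)"
    by code_simp
  moreover have "length triangle_flags = 12" by (simp add: triangle_flags_def)
  ultimately show ?thesis using assms by simp
qed

text \<open>
  No \<open>u i\<close> is trivial, since it would be the \<open>k\<close>-th power of another one, and likewise for \<open>w\<close>.  With
  the unit adjoined under the index 0, being a power is therefore ``index 0 or equal indices'' in both
  families, that is, \<open>flag_le\<close> in each component.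
\<close>

lemma (in group) triangle_not_chordal:
  fixes k :: nat and u w :: "nat \<Rightarrow> 'a"
  assumes k: "odd k"
    and u: "\<And>i. i \<in> {1,2,3} \<Longrightarrow> u i \<in> carrier G \<and> u i [^] k = \<one>"
    and w: "\<And>i. i \<in> {1,2,3} \<Longrightarrow> w i \<in> carrier G \<and> w i [^] (2::nat) = \<one>"
    and comm: "\<And>i j. i \<in> {1,2,3} \<Longrightarrow> j \<in> {1,2,3} \<Longrightarrow> i \<noteq> j \<Longrightarrow> u i \<otimes> w j = w j \<otimes> u i"
    and u_indep: "\<And>i j m::nat. i \<in> {1,2,3} \<Longrightarrow> j \<in> {1,2,3} \<Longrightarrow> u i = u j [^] m \<Longrightarrow> i = j"
    and w_indep: "\<And>i j m::nat. i \<in> {1,2,3} \<Longrightarrow> j \<in> {1,2,3} \<Longrightarrow> w i = w j [^] m \<Longrightarrow> i = j"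
  shows "\<not> chordal (power_graph G)"
proof -
  define U where "U i = (if i = 0 then \<one> else u i)" for i
  define W where "W i = (if i = 0 then \<one> else w i)" for i
  let ?I = "{0,1,2,3} :: nat set"
  have U_carr: "U i \<in> carrier G" "U i [^] k = \<one>" if "i \<in> ?I" for i
    using that u by (auto simp: U_def)
  have W_carr: "W i \<in> carrier G" "W i [^] (2::nat) = \<one>" if "i \<in> ?I" for i
    using that w by (auto simp: W_def)
  have pow_iff: "(\<exists>m::nat. m > 0 \<and> X i = X j [^] m) \<longleftrightarrow> i = 0 \<or> i = j"
    if X: "\<And>i. X i = (if i = 0 then \<one> else x i)" and e: "e > 0"
      and x: "\<And>i. i \<in> {1,2,3} \<Longrightarrow> x i \<in> carrier G \<and> x i [^] e = \<one>"
      and indep: "\<And>i j m::nat. i \<in> {1,2,3} \<Longrightarrow> j \<in> {1,2,3} \<Longrightarrow> x i = x j [^] m \<Longrightarrow> i = j"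
      and ij: "i \<in> ?I" "j \<in> ?I"
    for X x :: "nat \<Rightarrow> 'a" and e i j :: nat
  proof
    assume "\<exists>m::nat. m > 0 \<and> X i = X j [^] m"
    then obtain m :: nat where m: "X i = X j [^] m" by blast
    show "i = 0 \<or> i = j"
    proof (rule ccontr)
      assume ne: "\<not> (i = 0 \<or> i = j)"
      then have i: "i \<in> {1,2,3}" using ij by auto
      show False
      proof (cases "j = 0")
        case True
        obtain l where l: "l \<in> {1,2,3::nat}" "l \<noteq> i" by (metis insertCI numeral_eq_one_iff semiring_norm(84))
        have "x i = \<one>" using m ne True by (simp add: X)
        then have "x i = x l [^] e" using x[OF l(1)] by simp
        then show False using indep[OF i l(1), of e] l(2) by simp
      next
        case False
        then have j: "j \<in> {1,2,3}" using ij by auto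
        show False using m indep[OF i j, of m] ne False by (simp add: X)
      qed
    qed
  next
    assume "i = 0 \<or> i = j"
    then show "\<exists>m::nat. m > 0 \<and> X i = X j [^] m"
    proof
      assume "i = 0"
      have "X j [^] e = \<one>" using ij x[of j] by (auto simp: X)
      with \<open>i = 0\<close> e show ?thesis by (intro exI[of _ e]) (simp add: X)
    next
      assume "i = j"
      moreover have "X j \<in> carrier G" using ij x[of j] by (auto simp: X)
      ultimately show ?thesis by (intro exI[of _ 1]) simp
    qed
  qed
  have kpos: "k > 0" using k by (rule odd_pos)
  have mem: "fst x \<in> ?I" "snd x \<in> ?I" "fst x \<noteq> snd x" if "x \<in> set triangle_flags" for x
    using that by (auto simp: triangle_flags_def)
  have UW: "U i \<otimes> W j = W j \<otimes> U i" if "i \<in> ?I" "j \<in> ?I" "i \<noteq> j" for i j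
  proof (cases "i = 0 \<or> j = 0")
    case True
    then show ?thesis using that U_carr[of i] W_carr[of j] by (auto simp: U_def W_def)
  next
    case False
    then show ?thesis using that comm[of i j] by (auto simp: U_def W_def)
  qed
  show ?thesis
  proof (rule not_chordal_if_power_order[where f = "\<lambda>x. U (fst x) \<otimes> W (snd x)" 
        and L = triangle_flags and R = flag_le])
    fix x y assume xy: "x \<in> set triangle_flags" "y \<in> set triangle_flags"
    have "(\<exists>m::nat. m > 0 \<and> U (fst x) = U (fst y) [^] m) \<longleftrightarrow> fst x = 0 \<or> fst x = fst y"
      by (rule pow_iff[OF U_def kpos u u_indep]) (use mem[OF xy(1)] mem[OF xy(2)] in auto)
    moreover have "(\<exists>m::nat. m > 0 \<and> W (snd x) = W (snd y) [^] m) \<longleftrightarrow> snd x = 0 \<or> snd x = snd y"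
      by (rule pow_iff[OF W_def pos2 w w_indep]) (use mem[OF xy(1)] mem[OF xy(2)] in auto)
    ultimately show "(\<exists>m::nat. m > 0 \<and> U (fst x) \<otimes> W (snd x) = (U (fst y) \<otimes> W (snd y)) [^] m) \<longleftrightarrow> flag_le x y"
      unfolding flag_le_def
      using prod_is_power_iff[OF k U_carr(1)[OF mem(1)] W_carr(1)[OF mem(2)]
          U_carr(1)[OF mem(1)] W_carr(1)[OF mem(2)] UW[OF mem] UW[OF mem]
          U_carr(2)[OF mem(1)] U_carr(2)[OF mem(1)] W_carr(2)[OF mem(2)] W_carr(2)[OF mem(2)],
          OF xy(1,1,2,2,1,1,1,2,2,2,1,2,1,2)]
      by simp
    show "x = y" if "flag_le x y" "flag_le y x"
      using that by (auto simp: flag_le_def prod_eq_iff)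
  next
    show "distinct triangle_flags" "4 \<le> length triangle_flags"
      by (simp_all add: triangle_flags_def)
  qed (use mem U_carr W_carr triangle_flags_cycle in auto)
qed

text \<open>
  Commutativity descends to the quotient, and the obstruction to being a power can be checked
  upstairs: if the coset of \<open>x\<close> is a power of the coset of \<open>y\<close>, then \<open>x = z \<otimes> y [^] m\<close> with \<open>z\<close>
  central, so \<open>x\<close> commutes with \<open>y\<close>.
\<close>

lemma (in group) center_quotient_not_chordal:
  fixes k :: nat and u w :: "nat \<Rightarrow> 'a"
  assumes k: "odd k"
    and u: "\<And>i. i \<in> {1,2,3} \<Longrightarrow> u i \<in> carrier G \<and> u i [^] k = \<one>"
    and w: "\<And>i. i \<in> {1,2,3} \<Longrightarrow> w i \<in> carrier G \<and> w i [^] (2::nat) = \<one>"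
    and comm: "\<And>i j. i \<in> {1,2,3} \<Longrightarrow> j \<in> {1,2,3} \<Longrightarrow> i \<noteq> j \<Longrightarrow> u i \<otimes> w j = w j \<otimes> u i"
    and u_nc: "\<And>i j. i \<in> {1,2,3} \<Longrightarrow> j \<in> {1,2,3} \<Longrightarrow> u i \<otimes> u j = u j \<otimes> u i \<Longrightarrow> i = j"
    and w_nc: "\<And>i j. i \<in> {1,2,3} \<Longrightarrow> j \<in> {1,2,3} \<Longrightarrow> w i \<otimes> w j = w j \<otimes> w i \<Longrightarrow> i = j"
  shows "\<not> chordal (power_graph (G Mod group_center G))"
proof -
  let ?Z = "group_center G" and ?Q = "G Mod group_center G"
  interpret N: normal ?Z G by (rule group_center_normal)
  interpret Q: group ?Q by (rule N.factorgroup_is_group)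
  interpret hom: group_hom G ?Q "\<lambda>g. ?Z #> g"
    by unfold_locales (rule N.r_coset_hom_Mod)
  have commute: "x \<otimes> y = y \<otimes> x"
    if xy: "x \<in> carrier G" "y \<in> carrier G" and eq: "?Z #> x = (?Z #> y) [^]\<^bsub>?Q\<^esub> m"
    for x y and m :: nat
  proof -
    have "?Z #> x = ?Z #> (y [^] m)" using eq xy by (simp add: hom.hom_nat_pow)
    moreover have "x \<in> ?Z #> x" using xy by (simp add: rcos_self N.subgroup_axioms)
    ultimately obtain z where z: "z \<in> ?Z" "x = z \<otimes> y [^] m"
      unfolding r_coset_def by blast
    have zc: "z \<in> carrier G" using z(1) unfolding group_center_def by blast
    have zy: "z \<otimes> y = y \<otimes> z" using z(1) xy(2) unfolding group_center_def by blast
    have ym: "y [^] m \<otimes> y = y \<otimes> y [^] m" using xy by (metis nat_pow_Suc nat_pow_Suc2)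
    have "x \<otimes> y = z \<otimes> (y [^] m \<otimes> y)"
      unfolding z(2) using zc xy(2) by (intro m_assoc) simp_all
    also have "\<dots> = (z \<otimes> y) \<otimes> y [^] m"
      unfolding ym using zc xy(2) by (intro m_assoc[symmetric]) simp_all
    also have "\<dots> = y \<otimes> x"
      unfolding zy z(2) using zc xy(2) by (intro m_assoc) simp_all
    finally show ?thesis .
  qed
  show ?thesis
  proof (rule Q.triangle_not_chordal[OF k, where u = "\<lambda>i. ?Z #> u i" and w = "\<lambda>i. ?Z #> w i"])
    show "?Z #> u i \<in> carrier ?Q \<and> (?Z #> u i) [^]\<^bsub>?Q\<^esub> k = \<one>\<^bsub>?Q\<^esub>" if "i \<in> {1,2,3}" for i
      using u[OF that] by (metis hom.hom_closed hom.hom_nat_pow hom.hom_one)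
    show "?Z #> w i \<in> carrier ?Q \<and> (?Z #> w i) [^]\<^bsub>?Q\<^esub> (2::nat) = \<one>\<^bsub>?Q\<^esub>" if "i \<in> {1,2,3}" for i
      using w[OF that] by (metis hom.hom_closed hom.hom_nat_pow hom.hom_one)
    show "(?Z #> u i) \<otimes>\<^bsub>?Q\<^esub> (?Z #> w j) = (?Z #> w j) \<otimes>\<^bsub>?Q\<^esub> (?Z #> u i)"
      if "i \<in> {1,2,3}" "j \<in> {1,2,3}" "i \<noteq> j" for i j
      using comm[OF that] u[OF that(1)] w[OF that(2)] by (metis hom.hom_mult)
    show "i = j" if "i \<in> {1,2,3}" "j \<in> {1,2,3}" "?Z #> u i = (?Z #> u j) [^]\<^bsub>?Q\<^esub> m"
      for i j and m :: nat
      using commute[OF _ _ that(3)] u[OF that(1)] u[OF that(2)] u_nc[OF that(1,2)] by blast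
    show "i = j" if "i \<in> {1,2,3}" "j \<in> {1,2,3}" "?Z #> w i = (?Z #> w j) [^]\<^bsub>?Q\<^esub> m"
      for i j and m :: nat
      using commute[OF _ _ that(3)] w[OF that(1)] w[OF that(2)] w_nc[OF that(1,2)] by blast
  qed
qed

section \<open>Scalar plus rank-one Hermitian matrices\<close>

definition herm_form :: "nat \<Rightarrow> 'k::field ^ 'n \<Rightarrow> 'k ^ 'n \<Rightarrow> 'k" where
  "herm_form q v w = (\<Sum>i\<in>UNIV. (v $ i) ^ q * w $ i)"

text \<open>
  The matrix \<open>\<alpha> + \<beta> v v\<^sup>*\<close>, where \<open>v\<^sup>*\<close> is the conjugate transpose of the column \<open>v\<close>.
  It is a transvection for \<open>\<alpha> = 1\<close> and \<open>v\<close> isotropic, and the involution that fixes \<open>v\<close> and negates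
  its orthogonal complement for \<open>\<alpha> = - 1\<close> and \<open>\<beta> * herm_form q v v = 2\<close>.
\<close>

definition rank_one_pert :: "nat \<Rightarrow> 'k::field \<Rightarrow> 'k \<Rightarrow> 'k ^ 'n \<Rightarrow> 'k ^ 'n ^ 'n" where
  "rank_one_pert q \<alpha> \<beta> v = (\<chi> i j. (if i = j then \<alpha> else 0) + \<beta> * (v $ i * (v $ j) ^ q))"

lemma rank_one_pert_mult_nth:
  fixes v w :: "'k::field ^ 'n"
  shows "(rank_one_pert q \<alpha> \<beta> v ** rank_one_pert q \<gamma> \<delta> w) $ i $ j =
    (if i = j then \<alpha> * \<gamma> else 0) + \<alpha> * \<delta> * (w $ i * (w $ j) ^ q) + \<beta> * \<gamma> * (v $ i * (v $ j) ^ q)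
    + \<beta> * \<delta> * herm_form q v w * (v $ i * (w $ j) ^ q)"
proof -
  have "(rank_one_pert q \<alpha> \<beta> v ** rank_one_pert q \<gamma> \<delta> w) $ i $ j =
     (\<Sum>k\<in>UNIV. ((if i = k then \<alpha> else 0) + \<beta> * (v $ i * (v $ k) ^ q)) *
       ((if k = j then \<gamma> else 0) + \<delta> * (w $ k * (w $ j) ^ q)))"
    by (simp add: matrix_matrix_mult_def rank_one_pert_def)
  also have "\<dots> = (\<Sum>k\<in>UNIV. (if k = i then (if i = j then \<alpha> * \<gamma> else 0) + \<alpha> * \<delta> * (w $ i * (w $ j) ^ q) else 0)
       + (if k = j then \<beta> * \<gamma> * (v $ i * (v $ j) ^ q) else 0)
       + \<beta> * \<delta> * (v $ i * (w $ j) ^ q) * ((v $ k) ^ q * w $ k))"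
    by (intro sum.cong refl) (auto simp: algebra_simps)
  also have "\<dots> = (if i = j then \<alpha> * \<gamma> else 0) + \<alpha> * \<delta> * (w $ i * (w $ j) ^ q) + \<beta> * \<gamma> * (v $ i * (v $ j) ^ q)
       + \<beta> * \<delta> * (v $ i * (w $ j) ^ q) * herm_form q v w"
    by (simp add: sum.distrib herm_form_def sum_distrib_left)
  finally show ?thesis by (simp add: mult_ac)
qed

lemma rank_one_pert_mult_same:
  "rank_one_pert q \<alpha> \<beta> v ** rank_one_pert q \<gamma> \<delta> v =
   rank_one_pert q (\<alpha> * \<gamma>) (\<alpha> * \<delta> + \<beta> * \<gamma> + \<beta> * \<delta> * herm_form q v v) v"
  by (simp add: vec_eq_iff rank_one_pert_mult_nth) (simp add: rank_one_pert_def algebra_simps)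

text \<open>
  The commutator of \<open>v v\<^sup>*\<close> and \<open>w w\<^sup>*\<close> is \<open>\<langle>v, w\<rangle> v w\<^sup>* - \<langle>w, v\<rangle> w v\<^sup>*\<close>; the scalar parts do not contribute.
\<close>

lemma rank_one_pert_commute_iff:
  assumes "\<beta> \<noteq> 0" "\<delta> \<noteq> 0"
  shows "rank_one_pert q \<alpha> \<beta> v ** rank_one_pert q \<gamma> \<delta> w = rank_one_pert q \<gamma> \<delta> w ** rank_one_pert q \<alpha> \<beta> v
    \<longleftrightarrow> (\<forall>i j. herm_form q v w * (v $ i * (w $ j) ^ q) = herm_form q w v * (w $ i * (v $ j) ^ q))"
proof -
  have eq: "(rank_one_pert q \<alpha> \<beta> v ** rank_one_pert q \<gamma> \<delta> w) $ i $ j = (rank_one_pert q \<gamma> \<delta> w ** rank_one_pert q \<alpha> \<beta> v) $ i $ j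
     \<longleftrightarrow> herm_form q v w * (v $ i * (w $ j) ^ q) = herm_form q w v * (w $ i * (v $ j) ^ q)" for i j
  proof -
    have "(rank_one_pert q \<alpha> \<beta> v ** rank_one_pert q \<gamma> \<delta> w) $ i $ j - (rank_one_pert q \<gamma> \<delta> w ** rank_one_pert q \<alpha> \<beta> v) $ i $ j
      = \<beta> * \<delta> * (herm_form q v w * (v $ i * (w $ j) ^ q) - herm_form q w v * (w $ i * (v $ j) ^ q))"
      by (simp add: rank_one_pert_mult_nth algebra_simps)
    then show ?thesis using assms by (metis eq_iff_diff_eq_0 mult_eq_0_iff)
  qed
  show ?thesis unfolding vec_eq_iff eq ..
qed

text \<open>
  Applying the vanishing commutator to \<open>w\<close> and cancelling \<open>\<langle>v, w\<rangle>\<close> would give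
  \<open>\<langle>w, w\<rangle> v = \<langle>w, v\<rangle> w\<close>; one coordinate \<open>i\<close> suffices to refute this.
\<close>

lemma rank_one_pert_not_commute:
  assumes nz: "\<beta> \<noteq> 0" "\<delta> \<noteq> 0" and vw: "herm_form q v w \<noteq> 0"
    and i: "v $ i * herm_form q w w \<noteq> herm_form q w v * w $ i"
  shows "rank_one_pert q \<alpha> \<beta> v ** rank_one_pert q \<gamma> \<delta> w \<noteq> rank_one_pert q \<gamma> \<delta> w ** rank_one_pert q \<alpha> \<beta> v"
proof
  assume "rank_one_pert q \<alpha> \<beta> v ** rank_one_pert q \<gamma> \<delta> w = rank_one_pert q \<gamma> \<delta> w ** rank_one_pert q \<alpha> \<beta> v"
  then have *: "herm_form q v w * (v $ i * (w $ j) ^ q) = herm_form q w v * (w $ i * (v $ j) ^ q)" for j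
    using rank_one_pert_commute_iff[OF nz] by blast
  have "herm_form q v w * (v $ i * herm_form q w w) =
        (\<Sum>j\<in>UNIV. herm_form q v w * (v $ i * (w $ j) ^ q) * w $ j)"
    by (simp add: herm_form_def[of q w w] sum_distrib_left mult_ac)
  also have "\<dots> = (\<Sum>j\<in>UNIV. herm_form q w v * (w $ i * (v $ j) ^ q) * w $ j)"
    by (simp only: *)
  also have "\<dots> = herm_form q v w * (herm_form q w v * w $ i)"
    by (subst (2) herm_form_def) (simp add: sum_distrib_left sum_distrib_right mult_ac)
  finally show False using vw i by simp
qed

lemma rank_one_pert_0: "rank_one_pert q 1 0 v = mat 1"
  by (simp add: rank_one_pert_def mat_def)

lemma det_rank_one_pert:
  fixes v :: "'k::field ^ 3"
  shows "det (rank_one_pert q \<alpha> \<beta> v) = \<alpha> ^ 3 + \<alpha> ^ 2 * \<beta> * herm_form q v v"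
  by (simp add: det_3 rank_one_pert_def herm_form_def sum_3 algebra_simps power3_eq_cube power2_eq_square)

lemma transvection_power:
  fixes v :: "'k::field ^ 'n"
  assumes "herm_form q v v = 0"
  shows "rank_one_pert q 1 c v [^]\<^bsub>SU q\<^esub> m = rank_one_pert q 1 (of_nat m * c) v"
proof (induction m)
  case 0
  then show ?case by (simp add: SU_def rank_one_pert_0)
next
  case (Suc m)
  then have "rank_one_pert q 1 c v [^]\<^bsub>SU q\<^esub> Suc m = rank_one_pert q 1 (of_nat m * c) v ** rank_one_pert q 1 c v"
    by (simp add: SU_def)
  then show ?case using assms by (simp add: rank_one_pert_mult_same algebra_simps)
qed

lemma involution_mult_self:
  fixes v :: "'k::field ^ 'n"
  assumes "s * herm_form q v v = 1"
  shows "rank_one_pert q (-1) (2 * s) v ** rank_one_pert q (-1) (2 * s) v = mat 1"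
proof -
  have "-1 * (2 * s) + 2 * s * -1 + 2 * s * (2 * s) * herm_form q v v
      = 4 * s * (s * herm_form q v v - 1)"
    by (simp add: algebra_simps)
  also have "\<dots> = 0" using assms by simp
  finally show ?thesis
    unfolding rank_one_pert_mult_same by (simp only: rank_one_pert_0) (simp add: rank_one_pert_0)
qed

lemma involution_order:
  fixes v :: "'k::field ^ 'n"
  assumes "s * herm_form q v v = 1"
  shows "rank_one_pert q (-1) (2 * s) v [^]\<^bsub>SU q\<^esub> (2::nat) = \<one>\<^bsub>SU q\<^esub>"
  using involution_mult_self[OF assms] by (simp add: SU_def numeral_2_eq_2)

section \<open>Finite fields of square order\<close>

lemma finite_field_power_card_minus_1:
  fixes x :: "'k::{field,finite}"
  assumes "x \<noteq> 0"
  shows "x ^ (CARD('k) - 1) = 1"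
proof -
  have "x ^ (CARD('k) - 1) * (\<Prod>y\<in>UNIV-{0}. y) = (\<Prod>y\<in>UNIV-{0}. x * y)"
    by (simp add: prod.distrib)
  also have "\<dots> = (\<Prod>y\<in>UNIV-{0}. y)"
    by (rule prod.reindex_bij_witness[of _ "\<lambda>y. y / x" "\<lambda>y. x * y"]) (use assms in auto)
  finally show ?thesis by (simp add: prod_zero_iff)
qed

context
  fixes p n q :: nat
  assumes p: "prime p" and q: "q = p ^ n"
    and card: "CARD('k::{field,finite}) = q ^ 2"
begin

lemma CHAR_square_order: "CHAR('k) = p"
proof -
  have prime: "prime CHAR('k)" by (rule prime_CHAR_semidom) (simp add: finite_imp_CHAR_pos)
  moreover have "CHAR('k) dvd p ^ (n * 2)"
    using CHAR_dvd_CARD[where 'a='k] card q by (simp add: power_mult)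
  ultimately show ?thesis
    using p prime_dvd_power primes_dvd_imp_eq by blast
qed

lemma conj_add: "(x + y) ^ q = x ^ q + (y :: 'k) ^ q"
  using freshmans_dream'[of q n x y] p q by (simp add: CHAR_square_order)

lemma conj_conj: "((x :: 'k) ^ q) ^ q = x"
proof (cases "x = 0")
  case False
  have "q ^ 2 > 0" using p q by (simp add: prime_gt_0_nat)
  then have "x ^ (q ^ 2) = x * x ^ (CARD('k) - 1)"
    by (simp add: card flip: power_Suc)
  then show ?thesis
    using finite_field_power_card_minus_1[OF False] by (simp add: power2_eq_square power_mult)
qed (use p q in \<open>simp add: prime_gt_0_nat\<close>)

lemma two_neq_zero: "odd p \<Longrightarrow> (2 :: 'k) \<noteq> 0"
proof
  assume "odd p" "(2 :: 'k) = 0"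
  then have "of_nat 2 = (0 :: 'k)" by simp
  then have "p dvd 2" by (simp only: of_nat_eq_0_iff_char_dvd CHAR_square_order)
  then show False using p \<open>odd p\<close> by (metis two_is_prime_nat primes_dvd_imp_eq)
qed

text \<open>
  Since \<open>x ^ (q\<^sup>2 - 1) = 1\<close> for \<open>x \<noteq> 0\<close>, the value \<open>x ^ ((q\<^sup>2 - 1) / 2)\<close> is \<open>\<plusminus>1\<close>.  It is not always 1,
  because the polynomial \<open>X ^ ((q\<^sup>2 - 1) / 2) - 1\<close> has too few roots.
\<close>

lemma exists_nonsquare:
  assumes "odd p"
  shows "\<exists>x :: 'k. x ^ ((q ^ 2 - 1) div 2) = -1"
proof (rule ccontr)
  assume no: "\<nexists>x :: 'k. x ^ ((q ^ 2 - 1) div 2) = -1"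
  let ?h = "(q ^ 2 - 1) div 2"
  have oq: "odd (q ^ 2)" using assms q by simp
  then have h: "2 * ?h = q ^ 2 - 1" by simp
  have ge: "q ^ 2 \<ge> 2"
    using card card_mono[of "UNIV :: 'k set" "{0, 1}"] by simp
  then have h0: "?h > 0" using h oq by (cases "q ^ 2 = 2") auto
  have all: "x ^ ?h = 1" if "x \<noteq> 0" for x :: 'k
  proof -
    have "(x ^ ?h) ^ 2 = 1"
      using finite_field_power_card_minus_1[OF that] h card
      by (metis mult.commute power_mult)
    then show ?thesis using no by (auto simp: power2_eq_1_iff)
  qed
  let ?P = "monom 1 ?h - 1 :: 'k poly"
  have deg: "degree ?P \<le> ?h"
    by (rule degree_diff_le) (simp_all add: degree_monom_le)
  have "coeff ?P ?h = 1" using h0 by simp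
  then have P0: "?P \<noteq> 0" by (metis coeff_0 zero_neq_one)
  have "UNIV - {0} \<subseteq> {x. poly ?P x = 0}"
    using all by (auto simp: poly_monom)
  then have "card (UNIV - {0 :: 'k}) \<le> card {x. poly ?P x = 0}"
    by (intro card_mono) auto
  also have "\<dots> \<le> ?h" using card_poly_roots_bound[OF P0] deg by linarith
  finally have "q ^ 2 - 1 \<le> ?h" by (simp add: card)
  then show False using h h0 by linarith
qed

text \<open>
  Both elements are powers of one nonsquare \<open>x\<close>: in \<open>(q\<^sup>2 - 1) / 2 = ((q - 1) / 2) (q + 1) =
  ((q + 1) / 2) (q - 1)\<close> the first factorization shows that \<open>a = x ^ ((q - 1) / 2)\<close> has norm
  \<open>a ^ (q + 1) = - 1\<close>, the second that \<open>c = x ^ ((q + 1) / 2)\<close> satisfies \<open>c ^ (q - 1) = - 1\<close>.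
\<close>

lemma exists_norm_minus_one_and_skew:
  assumes "odd p"
  shows "\<exists>(a :: 'k) (c :: 'k). a * a ^ q = -1 \<and> c \<noteq> 0 \<and> c ^ q = - c"
proof -
  obtain x :: 'k where x: "x ^ ((q ^ 2 - 1) div 2) = -1" using exists_nonsquare[OF assms] ..
  have oq: "odd q" using assms q by simp
  then obtain r where r: "q = 2 * r + 1" by (elim oddE)
  have e: "(q ^ 2 - 1) div 2 = r * (q + 1)" "(q ^ 2 - 1) div 2 = (r + 1) * (q - 1)"
    by (simp_all add: r power2_eq_square algebra_simps)
  have "x \<noteq> 0"
  proof
    assume "x = 0"
    moreover have "r \<noteq> 0"
    proof
      assume "r = 0"
      then have "CARD('k) = 1" using card by (simp add: r)
      then show False using card_mono[of "UNIV :: 'k set" "{0, 1}"] by simp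
    qed
    ultimately have "x ^ (r * (q + 1)) = 0" by simp
    then have "(-1 :: 'k) = 0" using x[unfolded e(1)] by (simp only:)
    then show False by simp
  qed
  have "x ^ r * (x ^ r) ^ q = -1"
    using x unfolding e(1) power_mult power_add by (simp add: mult.commute)
  moreover have "(x ^ (r + 1)) ^ q = x ^ (r + 1) * (x ^ (r + 1)) ^ (q - 1)"
    using oq by (cases q) simp_all
  then have "(x ^ (r + 1)) ^ q = - (x ^ (r + 1))"
    using x unfolding e(2) power_mult by simp
  moreover have "x ^ (r + 1) \<noteq> 0" using \<open>x \<noteq> 0\<close> by simp
  ultimately show ?thesis by blast
qed

lemma conj_transpose_rank_one_pert:
  "conj_transpose q (rank_one_pert q \<alpha> \<beta> (v :: 'k ^ 'n)) = rank_one_pert q (\<alpha> ^ q) (\<beta> ^ q) v"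
proof -
  have "q > 0" using p q by (simp add: prime_gt_0_nat)
  then show ?thesis
    by (auto simp: conj_transpose_def rank_one_pert_def vec_eq_iff conj_add power_mult_distrib
        conj_conj mult.commute)
qed

text \<open>
  The condition \<open>c ^ q = - c\<close> makes \<open>1 - c v v\<^sup>*\<close> both the inverse and the conjugate transpose of
  \<open>1 + c v v\<^sup>*\<close>.
\<close>

lemma transvection_in_SU:
  fixes v :: "'k ^ 3"
  assumes "herm_form q v v = 0" "c ^ q = - c"
  shows "rank_one_pert q 1 c v \<in> carrier (SU q)"
  using assms
  by (simp add: SU_def conj_transpose_rank_one_pert rank_one_pert_mult_same
      det_rank_one_pert rank_one_pert_0)

lemma transvection_order:
  fixes v :: "'k ^ 3"
  assumes "herm_form q v v = 0"
  shows "rank_one_pert q 1 c v [^]\<^bsub>SU q\<^esub> p = \<one>\<^bsub>SU q\<^esub>"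
proof -
  have "of_nat p = (0 :: 'k)"
    using CHAR_square_order of_nat_CHAR[where 'a = 'k] by simp
  then show ?thesis
    using transvection_power[OF assms, of c p] by (simp add: SU_def rank_one_pert_0)
qed

text \<open>
  The matrix is its own conjugate transpose and its own inverse; its eigenvalues are 1 on \<open>v\<close> and
  \<open>- 1\<close> twice, so in dimension 3 its determinant is 1.
\<close>

lemma involution_in_SU:
  fixes v :: "'k ^ 3"
  assumes "odd p" and s: "s * herm_form q v v = 1" "s ^ q = s"
  shows "rank_one_pert q (-1) (2 * s) v \<in> carrier (SU q)"
proof -
  have "(2 :: 'k) ^ q = 2"
    using conj_add[of 1 1] by simp
  moreover have "(- 1 :: 'k) ^ q = - 1" using \<open>odd p\<close> q by simp
  moreover have "det (rank_one_pert q (-1) (2 * s) v) = -1 + 2 * (s * herm_form q v v)"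
    by (simp add: det_rank_one_pert)
  ultimately show ?thesis
    using s involution_mult_self[OF s(1)]
    by (simp add: SU_def conj_transpose_rank_one_pert power_mult_distrib)
qed

end

section \<open>The triangle in the unitary group\<close>

theorem theorem5p4:
  fixes p n q :: nat
  assumes "prime p" and "odd p" and "n > 0" and "q = p ^ n"
    and "CARD('k::{field,finite}) = q ^ 2"
  shows "\<not> chordal (power_graph (PSU q :: ('k ^ 3 ^ 3) set monoid))"
proof -
  note p = assms(1) and q = assms(4) and card = assms(5)
  have qpos: "q > 0" using p q by (simp add: prime_gt_0_nat)
  have oq: "odd q" using assms(2) q by simp
  have two: "(2 :: 'k) \<noteq> 0" using two_neq_zero[OF p q card] assms(2) .
  obtain a c :: 'k where a: "a * a ^ q = -1" and c: "c \<noteq> 0" "c ^ q = - c"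
    using exists_norm_minus_one_and_skew[OF p q card assms(2)] by blast
  define b where "b = a ^ q"
  have ab: "a * b = -1" "b * a = -1" using a by (simp_all add: b_def mult.commute)
  have nz: "a \<noteq> 0" "b \<noteq> 0" using ab by auto
  have conj: "a ^ q = b" "b ^ q = a" "(- a) ^ q = - b" "(- b) ^ q = - a" "(0::'k) ^ q = 0"
    using conj_conj[OF p q card, of a] oq qpos by (simp_all add: b_def)
  (* Three isotropic vectors spanning the space.  The vector (1, -a, 0) is used as second
     vertex, not (a, 0, 1), because the cyclic shifts of (1, a, 0) are dependent when a^3 = -1. *)
  define P :: "nat \<Rightarrow> 'k ^ 3" where
    "P i = vector (if i = 1 then [1, a, 0] else if i = 2 then [1, - a, 0] else [0, 1, a])" for i
  (* N j spans the orthogonal complement of the two isotropic vectors with index other than j;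
     s j is its norm. *)
  define N :: "nat \<Rightarrow> 'k ^ 3" where
    "N i = vector (if i = 1 then [b, 1, a] else if i = 2 then [- b, 1, a] else [0, 0, 1])" for i
  define s :: "nat \<Rightarrow> 'k" where "s i = (if i = 3 then 1 else -1)" for i
  note form = herm_form_def sum_3 P_def N_def conj ab qpos
  have P_iso: "herm_form q (P i) (P i) = 0" if "i \<in> {1,2,3}" for i
    using that by (auto simp: form)
  have N_norm: "s i * herm_form q (N i) (N i) = 1" "s i ^ q = s i" "s i \<noteq> 0" if "i \<in> {1,2,3}" for i
    using that oq by (auto simp: form s_def)
  have orth: "herm_form q (P i) (N j) = 0" "herm_form q (N j) (P i) = 0"
    if "i \<in> {1,2,3}" "j \<in> {1,2,3}" "i \<noteq> j" for i j
    using that by (auto simp: form)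
  have PP: "herm_form q (P i) (P j) \<noteq> 0"
    if "i \<in> {1,2,3}" "j \<in> {1,2,3}" "i \<noteq> j" for i j
    using that nz two by (auto simp: form)
  have P_nz: "\<exists>r. P i $ r \<noteq> 0" if "i \<in> {1,2,3}" for i
  proof -
    have "P i $ 2 \<noteq> 0" using that nz by (auto simp: P_def)
    then show ?thesis ..
  qed
  have NN: "herm_form q (N i) (N j) \<noteq> 0"
    if "i \<in> {1,2,3}" "j \<in> {1,2,3}" "i \<noteq> j" for i j
    using that nz two by (auto simp: form)
  have minus_one: "(-1 :: 'k) \<noteq> 1"
    using two by (metis add.right_inverse one_add_one)
  have NN_nonprop: "\<exists>r. N i $ r * herm_form q (N j) (N j) \<noteq> herm_form q (N j) (N i) * N j $ r"
    if "i \<in> {1,2,3}" "j \<in> {1,2,3}" "i \<noteq> j" for i j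
  proof
    (* The third vector vanishes at coordinate 1 and the other two do not.  The first two are
       distinguished at coordinate 2, where the two sides are -1 and 1. *)
    let ?r = "if i = 3 \<or> j = 3 then 1 else 2 :: 3"
    show "N i $ ?r * herm_form q (N j) (N j) \<noteq> herm_form q (N j) (N i) * N j $ ?r"
      using that nz two minus_one by (auto simp: form)
  qed
  define u where "u i = rank_one_pert q 1 c (P i)" for i
  define w where "w i = rank_one_pert q (-1) (2 * s i) (N i)" for i
  interpret SU: group "SU q :: ('k ^ 3 ^ 3) monoid" by (rule group_SU[OF p q card])
  have mult: "x \<otimes>\<^bsub>SU q\<^esub> y = x ** y" for x y :: "'k ^ 3 ^ 3" by (simp add: SU_def)
  show ?thesis unfolding PSU_def
  proof (rule SU.center_quotient_not_chordal[OF assms(2), where u = u and w = w])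
    fix i j :: nat assume i: "i \<in> {1,2,3}"
    show "u i \<in> carrier (SU q) \<and> u i [^]\<^bsub>SU q\<^esub> p = \<one>\<^bsub>SU q\<^esub>"
      unfolding u_def using transvection_in_SU[OF p q card P_iso[OF i] c(2)]
        transvection_order[OF p q card P_iso[OF i]] by blast
    show "w i \<in> carrier (SU q) \<and> w i [^]\<^bsub>SU q\<^esub> (2::nat) = \<one>\<^bsub>SU q\<^esub>"
      unfolding w_def using involution_in_SU[OF p q card assms(2) N_norm(1,2)[OF i]]
        involution_order[OF N_norm(1)[OF i]] by blast
    assume j: "j \<in> {1,2,3}"
    have sj: "2 * s j \<noteq> 0" "2 * s i \<noteq> 0" using N_norm(3)[OF j] N_norm(3)[OF i] two by simp_all
    show "u i \<otimes>\<^bsub>SU q\<^esub> w j = w j \<otimes>\<^bsub>SU q\<^esub> u i" if "i \<noteq> j"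
      using orth[OF i j that] c sj(1) by (simp add: mult u_def w_def rank_one_pert_commute_iff)
    show "i = j" if "u i \<otimes>\<^bsub>SU q\<^esub> u j = u j \<otimes>\<^bsub>SU q\<^esub> u i"
    proof (rule ccontr)
      assume ne: "i \<noteq> j"
      obtain r where "P j $ r \<noteq> 0" using P_nz[OF j] ..
      then show False
        using that rank_one_pert_not_commute[OF c(1) c(1) PP[OF i j ne], of r 1 1]
          PP[OF j i ne[symmetric]] P_iso[OF j] by (simp add: mult u_def)
    qed
    show "i = j" if "w i \<otimes>\<^bsub>SU q\<^esub> w j = w j \<otimes>\<^bsub>SU q\<^esub> w i"
    proof (rule ccontr)
      assume ne: "i \<noteq> j"
      obtain r where "N i $ r * herm_form q (N j) (N j) \<noteq> herm_form q (N j) (N i) * N j $ r"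
        using NN_nonprop[OF i j ne] ..
      then show False
        using that rank_one_pert_not_commute[OF sj(2) sj(1) NN[OF i j ne], of r "-1" "-1"]
        by (simp add: mult w_def)
    qed
  qed
qed

end
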